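(* Let $\mathcal{M}_{\otimes} = \bigl( M; \cdot, \mathrm{wt}, (\ddot{e}^{\otimes}_i)_{i \in I}, (\ddot{f}^{\otimes}_i)_{i \in I}, (\ddot{\varepsilon}^{\otimes}_i)_{i \in I}, (\ddot{\varphi}^{\otimes}_i)_{i \in I} \bigr)$ be a $\otimes$-quasi-crystal monoid of type $\Phi$ which is equidivisible. For each $i \in I$, let $\ddot{e}^{\ddot{\otimes}}_i, \ddot{f}^{\ddot{\otimes}}_i : M \to M \sqcup \{\bot\}$ and $\ddot{\varepsilon}^{\ddot{\otimes}}_i, \ddot{\varphi}^{\ddot{\otimes}}_i : M \to \mathbb{Z} \cup \{+\infty\}$ be defined for each $x \in M$ by: (1) if $x = x_1 x_2$ for some $x_1, x_2 \in M$ satisfying $\ddot{\varphi}^{\otimes}_i(x_1) > 0$ and $\ddot{\varepsilon}^{\otimes}_i(x_2) > 0$, set $\ddot{e}^{\ddot{\otimes}}_i(x) = \ddot{f}^{\ddot{\otimes}}_i(x) = \bot$ and $\ddot{\varepsilon}^{\ddot{\otimes}}_i(x) = \ddot{\varphi}^{\ddot{\otimes}}_i(x) = +\infty$; (2) otherwise, set $\ddot{e}^{\ddot{\otimes}}_i(x) = \ddot{e}^{\otimes}_i(x)$, $\ddot{f}^{\ddot{\otimes}}_i(x) = \ddot{f}^{\otimes}_i(x)$, $\ddot{\varepsilon}^{\ddot{\otimes}}_i(x) = \ddot{\varepsilon}^{\otimes}_i(x)$, and $\ddot{\varphi}^{\ddot{\otimes}}_i(x) = \ddot{\varphi}^{\otimes}_i(x)$.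 Then $\mathcal{M}_{\ddot{\otimes}} = \bigl( M; \cdot, \mathrm{wt}, (\ddot{e}^{\ddot{\otimes}}_i)_{i \in I}, (\ddot{f}^{\ddot{\otimes}}_i)_{i \in I}, (\ddot{\varepsilon}^{\ddot{\otimes}}_i)_{i \in I}, (\ddot{\varphi}^{\ddot{\otimes}}_i)_{i \in I} \bigr)$ is a $\ddot{\otimes}$-quasi-crystal monoid (of type $\Phi$).
   Context: Root data. Let $V$ be a Euclidean space with inner product $\langle\cdot,\cdot\rangle$; for nonzero $\alpha \in V$ put $\alpha^\vee = \frac{2}{\langle\alpha,\alpha\rangle}\alpha$ and $r_\alpha(v) = v - \langle v,\alpha^\vee\rangle\alpha$. A root system $\Phi \subseteq V$ is a nonempty finite subset with $0 \notin \Phi$, $r_\alpha(\beta) \in \Phi$ and $\langle\alpha,\beta^\vee\rangle \in \mathbb{Z}$ for all $\alpha,\beta\in\Phi$, and such that $\alpha, k\alpha \in \Phi$ implies $k = \pm 1$. Fix simple roots $(\alpha_i)_{i\in I}$ (linearly independent roots such that every root is an integer combination of them with coefficients all nonnegative or all nonpositive) and a weight lattice $\Lambda$ (a $\mathbb{Z}$-submodule of $V$ spanning $V$, containing $\Phi$, with $\langle\lambda,\alpha^\vee\rangle\in\mathbb{Z}$ for all $\lambda\in\Lambda$, $\alpha\in\Phi$). Conventions. In $\mathbb{Z}\cup\{+\infty\}$, $m < +\infty$ and $m + (+\infty) = (+\infty) + m = +\infty$ for all $m\in\mathbb{Z}$. The symbol $\bot$ is an auxiliary symbol meaning "undefined";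 an operator is defined on $x$ if its value at $x$ is not $\bot$. Seminormal quasi-crystals. A seminormal quasi-crystal $\mathcal{Q}$ of type $\Phi$ is a set $Q$ with maps $\mathrm{wt}: Q\to\Lambda$, $\ddot e_i,\ddot f_i : Q\to Q\sqcup\{\bot\}$, $\ddot\varepsilon_i,\ddot\varphi_i: Q\to\mathbb{Z}\cup\{+\infty\}$ ($i\in I$) such that for all $x,y\in Q$, $i\in I$: (1) $\ddot\varphi_i(x) = \ddot\varepsilon_i(x) + \langle\mathrm{wt}(x),\alpha_i^\vee\rangle$; (2) if $\ddot e_i(x)\in Q$ then $\mathrm{wt}(\ddot e_i(x)) = \mathrm{wt}(x)+\alpha_i$; (3) if $\ddot f_i(x)\in Q$ then $\mathrm{wt}(\ddot f_i(x)) = \mathrm{wt}(x)-\alpha_i$; (4) $\ddot e_i(x)=y$ iff $x=\ddot f_i(y)$; (5) if $\ddot\varepsilon_i(x)=+\infty$ then $\ddot e_i(x)=\ddot f_i(x)=\bot$; (6) if $\ddot\varepsilon_i(x)\neq+\infty$ then $\ddot\varepsilon_i(x)=\max\{k\in\mathbb{Z}_{\ge0} : \ddot e_i^k(x)\in Q\}$ and $\ddot\varphi_i(x)=\max\{k\in\mathbb{Z}_{\ge0} : \ddot f_i^k(x)\in Q\}$. Homomorphisms. A quasi-crystal homomorphism $\psi:\mathcal{Q}\to\mathcal{Q}'$ (same type) is a map $\psi: Q\sqcup\{\bot\}\to Q'\sqcup\{\bot\}$ with $\psi(\bot)=\bot$ and, for $x\in Q$, $i\in I$: if $\psi(x)\in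 Q'$ then $\mathrm{wt}(\psi(x))=\mathrm{wt}(x)$, $\ddot\varepsilon_i(\psi(x))=\ddot\varepsilon_i(x)$, $\ddot\varphi_i(\psi(x))=\ddot\varphi_i(x)$; if $\ddot e_i(x)\in Q$ and $\psi(x),\psi(\ddot e_i(x))\in Q'$ then $\psi(\ddot e_i(x))=\ddot e_i(\psi(x))$; and likewise with $\ddot f_i$ in place of $\ddot e_i$. Tensor product. $\mathcal{Q}\otimes\mathcal{Q}'$ is the seminormal quasi-crystal on $Q\times Q'$ (pairs written $x\otimes x'$) with $\mathrm{wt}(x\otimes x')=\mathrm{wt}(x)+\mathrm{wt}(x')$; $\ddot e_i(x\otimes x')=\ddot e_i(x)\otimes x'$ if $\ddot\varphi_i(x)\ge\ddot\varepsilon_i(x')$ and $x\otimes\ddot e_i(x')$ if $\ddot\varphi_i(x)<\ddot\varepsilon_i(x')$; $\ddot f_i(x\otimes x')=\ddot f_i(x)\otimes x'$ if $\ddot\varphi_i(x)>\ddot\varepsilon_i(x')$ and $x\otimes\ddot f_i(x')$ if $\ddot\varphi_i(x)\le\ddot\varepsilon_i(x')$; $\ddot\varepsilon_i(x\otimes x')=\max\{\ddot\varepsilon_i(x),\ddot\varepsilon_i(x')-\langle\mathrm{wt}(x),\alpha_i^\vee\rangle\}$; $\ddot\varphi_i(x\otimes x')=\max\{\ddot\varphi_i(x)+\langle\mathrm{wt}(x'),\alpha_i^\vee\rangle,\ddot\varphi_i(x')\}$; here $x\otimes\bot=\bot\otimes x'=\bot$. Quasi-tensor product. $\mathcal{Q}\ddot\otimes\mathcal{Q}'$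 is the seminormal quasi-crystal on $Q\times Q'$ (pairs written $x\ddot\otimes x'$) with $\mathrm{wt}(x\ddot\otimes x')=\mathrm{wt}(x)+\mathrm{wt}(x')$ and: if $\ddot\varphi_i(x)>0$ and $\ddot\varepsilon_i(x')>0$, then $\ddot e_i(x\ddot\otimes x')=\ddot f_i(x\ddot\otimes x')=\bot$ and $\ddot\varepsilon_i(x\ddot\otimes x')=\ddot\varphi_i(x\ddot\otimes x')=+\infty$; otherwise $\ddot e_i,\ddot f_i,\ddot\varepsilon_i,\ddot\varphi_i$ on $x\ddot\otimes x'$ are given by the same formulas as for the tensor product (with $\ddot\otimes$ in place of $\otimes$). Quasi-crystal monoids. A $\otimes$-quasi-crystal monoid (respectively, $\ddot\otimes$-quasi-crystal monoid) $\mathcal{M}$ of type $\Phi$ is a set $M$ with maps $\mathrm{wt},\ddot e_i,\ddot f_i,\ddot\varepsilon_i,\ddot\varphi_i$ ($i\in I$) and a binary operation $\cdot$ such that the maps make $M$ a seminormal quasi-crystal of type $\Phi$, $(M,\cdot)$ is a monoid, and the map $x\otimes y\mapsto x\cdot y$ (respectively, $x\ddot\otimes y\mapsto x\cdot y$), extended by $\bot\mapsto\bot$, is a quasi-crystal homomorphism $\mathcal{M}\otimes\mathcal{M}\to\mathcal{M}$ (respectively, $\mathcal{M}\ddot\otimes\mathcal{M}\to\mathcal{M}$). Equidivisibility. A monoid $M$ is equidivisible if whenever $x_1y_1=x_2y_2$ with $x_1,x_2,y_1,y_2\in M$, there exists $z\in M$ such that $x_2=x_1z$ and $y_1=zy_2$,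 or such that $x_1=x_2z$ and $y_2=zy_1$. A quasi-crystal monoid is equidivisible if its underlying monoid is. *)

theory Defs
  imports "HOL-Analysis.Euclidean_Space" "HOL-Library.Extended" "HOL-Algebra.Group"
begin

definition coroot :: "'v::real_inner \<Rightarrow> 'v" where
  "coroot a = (2 / inner a a) *\<^sub>R a"

definition root_reflection :: "'v::real_inner \<Rightarrow> 'v \<Rightarrow> 'v" where
  "root_reflection a v = v - inner v (coroot a) *\<^sub>R a"

definition root_system :: "'v::euclidean_space set \<Rightarrow> bool" where
  "root_system \<Phi> \<longleftrightarrow>
     \<Phi> \<noteq> {} \<and> finite \<Phi> \<and> 0 \<notin> \<Phi> \<and>
     (\<forall>a\<in>\<Phi>. \<forall>b\<in>\<Phi>. root_reflection a b \<in> \<Phi>) \<and>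
     (\<forall>a\<in>\<Phi>. \<forall>b\<in>\<Phi>. inner a (coroot b) \<in> \<int>) \<and>
     (\<forall>a\<in>\<Phi>. \<forall>k::real. k *\<^sub>R a \<in> \<Phi> \<longrightarrow> k = 1 \<or> k = -1)"

text \<open>Injectivity together with independence of the image is linear independence of the
  family. The index set is then automatically finite, so the sum below is a genuine one.\<close>

definition simple_roots :: "'v::euclidean_space set \<Rightarrow> 'i set \<Rightarrow> ('i \<Rightarrow> 'v) \<Rightarrow> bool" where
  "simple_roots \<Phi> I \<alpha> \<longleftrightarrow>
     \<alpha> ` I \<subseteq> \<Phi> \<and> inj_on \<alpha> I \<and> independent (\<alpha> ` I) \<and>
     (\<forall>b\<in>\<Phi>. \<exists>c::'i \<Rightarrow> int. b = (\<Sum>i\<in>I. of_int (c i) *\<^sub>R \<alpha> i) \<and>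
        ((\<forall>i\<in>I. c i \<ge> 0) \<or> (\<forall>i\<in>I. c i \<le> 0)))"

definition weight_lattice :: "'v::euclidean_space set \<Rightarrow> 'v set \<Rightarrow> bool" where
  "weight_lattice \<Phi> \<Lambda> \<longleftrightarrow>
     0 \<in> \<Lambda> \<and> (\<forall>l\<in>\<Lambda>. \<forall>m\<in>\<Lambda>. l + m \<in> \<Lambda>) \<and> (\<forall>l\<in>\<Lambda>. \<forall>k::int. of_int k *\<^sub>R l \<in> \<Lambda>) \<and>
     span \<Lambda> = UNIV \<and> \<Phi> \<subseteq> \<Lambda> \<and>
     (\<forall>l\<in>\<Lambda>. \<forall>a\<in>\<Phi>. inner l (coroot a) \<in> \<int>)"

definition root_datum ::
    "'v::euclidean_space set \<Rightarrow> 'i set \<Rightarrow> ('i \<Rightarrow> 'v) \<Rightarrow> 'v set \<Rightarrow> bool" where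
  "root_datum \<Phi> I \<alpha> \<Lambda> \<longleftrightarrow> root_system \<Phi> \<and> simple_roots \<Phi> I \<alpha> \<and> weight_lattice \<Phi> \<Lambda>"

text \<open>The integer \<open>\<langle>l, a\<^sup>\<or>\<rangle>\<close> for a weight \<open>l\<close> and a root \<open>a\<close>; for these the inner product is
  an integer, so the floor only changes the type.\<close>

definition pairing :: "'v::euclidean_space \<Rightarrow> 'v \<Rightarrow> int" where
  "pairing l a = \<lfloor>inner l (coroot a)\<rfloor>"

text \<open>The set \<open>\<int> \<union> {+\<infinity>}\<close> inside \<^typ>\<open>int extended\<close>, which also has an element \<open>-\<infinity>\<close>.\<close>

definition zinf :: "int extended set" where
  "zinf = insert \<infinity> (range Fin)"

text \<open>The undefined symbol \<open>\<bottom>\<close> is rendered as \<^const>\<open>None\<close>. The underlying set is kept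
  outside the record, so that it can be shared with a monoid.\<close>

record ('q, 'i, 'v) quasi_crystal =
  wt :: "'q \<Rightarrow> 'v"
  qe :: "'i \<Rightarrow> 'q \<Rightarrow> 'q option"
  qf :: "'i \<Rightarrow> 'q \<Rightarrow> 'q option"
  qeps :: "'i \<Rightarrow> 'q \<Rightarrow> int extended"
  qphi :: "'i \<Rightarrow> 'q \<Rightarrow> int extended"

primrec iterate :: "('q \<Rightarrow> 'q option) \<Rightarrow> nat \<Rightarrow> 'q \<Rightarrow> 'q option" where
  "iterate g 0 x = Some x"
| "iterate g (Suc k) x = Option.bind (iterate g k x) g"

text \<open>\<open>m\<close> is the maximum of the \<open>k\<close> for which the \<open>k\<close>-fold iterate of \<open>g\<close> is defined on \<open>x\<close>;
  finiteness says that the maximum exists, as \<open>k = 0\<close> always qualifies.\<close>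

definition max_iterations :: "('q \<Rightarrow> 'q option) \<Rightarrow> 'q \<Rightarrow> int extended \<Rightarrow> bool" where
  "max_iterations g x m \<longleftrightarrow>
     finite {k. iterate g k x \<noteq> None} \<and> m = Fin (int (Max {k. iterate g k x \<noteq> None}))"

text \<open>The type \<open>\<Phi>\<close> enters only through the simple roots and the weight lattice.\<close>

definition seminormal_quasi_crystal ::
    "'i set \<Rightarrow> ('i \<Rightarrow> 'v::euclidean_space) \<Rightarrow> 'v set \<Rightarrow> 'q set \<Rightarrow> ('q, 'i, 'v) quasi_crystal \<Rightarrow> bool"
  where
  "seminormal_quasi_crystal I \<alpha> \<Lambda> Q C \<longleftrightarrow>
     (\<forall>x\<in>Q. wt C x \<in> \<Lambda>) \<and>
     (\<forall>i\<in>I. \<forall>x\<in>Q.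
        qe C i x \<in> insert None (Some ` Q) \<and> qf C i x \<in> insert None (Some ` Q) \<and>
        qeps C i x \<in> zinf \<and> qphi C i x \<in> zinf \<and>
        qphi C i x = qeps C i x + Fin (pairing (wt C x) (\<alpha> i)) \<and>
        (\<forall>y. qe C i x = Some y \<longrightarrow> wt C y = wt C x + \<alpha> i) \<and>
        (\<forall>y. qf C i x = Some y \<longrightarrow> wt C y = wt C x - \<alpha> i) \<and>
        (\<forall>y\<in>Q. qe C i x = Some y \<longleftrightarrow> qf C i y = Some x) \<and>
        (qeps C i x = \<infinity> \<longrightarrow> qe C i x = None \<and> qf C i x = None) \<and>
        (qeps C i x \<noteq> \<infinity> \<longrightarrow>
           max_iterations (qe C i) x (qeps C i x) \<and> max_iterations (qf C i) x (qphi C i x)))"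

definition quasi_crystal_hom ::
    "'i set \<Rightarrow> 'p set \<Rightarrow> ('p, 'i, 'v) quasi_crystal \<Rightarrow> 'q set \<Rightarrow> ('q, 'i, 'v) quasi_crystal
      \<Rightarrow> ('p option \<Rightarrow> 'q option) \<Rightarrow> bool" where
  "quasi_crystal_hom I P B Q C \<psi> \<longleftrightarrow>
     \<psi> None = None \<and> (\<forall>x\<in>P. \<psi> (Some x) \<in> insert None (Some ` Q)) \<and>
     (\<forall>x\<in>P. \<forall>y. \<psi> (Some x) = Some y \<longrightarrow>
        wt C y = wt B x \<and> (\<forall>i\<in>I. qeps C i y = qeps B i x \<and> qphi C i y = qphi B i x)) \<and>
     (\<forall>i\<in>I. \<forall>x\<in>P. \<forall>x' y y'.
        qe B i x = Some x' \<and> \<psi> (Some x) = Some y \<and> \<psi> (Some x') = Some y'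
          \<longrightarrow> qe C i y = Some y') \<and>
     (\<forall>i\<in>I. \<forall>x\<in>P. \<forall>x' y y'.
        qf B i x = Some x' \<and> \<psi> (Some x) = Some y \<and> \<psi> (Some x') = Some y'
          \<longrightarrow> qf C i y = Some y')"

text \<open>Both products live on the Cartesian product of the underlying sets.\<close>

definition tensor ::
    "('i \<Rightarrow> 'v::euclidean_space) \<Rightarrow> ('p, 'i, 'v) quasi_crystal \<Rightarrow> ('q, 'i, 'v) quasi_crystal
      \<Rightarrow> ('p \<times> 'q, 'i, 'v) quasi_crystal" where
  "tensor \<alpha> B C = \<lparr>
     wt = (\<lambda>(x, x'). wt B x + wt C x'),
     qe = (\<lambda>i (x, x').
       if qphi B i x \<ge> qeps C i x' then map_option (\<lambda>y. (y, x')) (qe B i x)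
       else map_option (\<lambda>y'. (x, y')) (qe C i x')),
     qf = (\<lambda>i (x, x').
       if qphi B i x > qeps C i x' then map_option (\<lambda>y. (y, x')) (qf B i x)
       else map_option (\<lambda>y'. (x, y')) (qf C i x')),
     qeps = (\<lambda>i (x, x').
       max (qeps B i x) (qeps C i x' - Fin (pairing (wt B x) (\<alpha> i)))),
     qphi = (\<lambda>i (x, x').
       max (qphi B i x + Fin (pairing (wt C x') (\<alpha> i))) (qphi C i x')) \<rparr>"

definition quasi_tensor ::
    "('i \<Rightarrow> 'v::euclidean_space) \<Rightarrow> ('p, 'i, 'v) quasi_crystal \<Rightarrow> ('q, 'i, 'v) quasi_crystal
      \<Rightarrow> ('p \<times> 'q, 'i, 'v) quasi_crystal" where
  "quasi_tensor \<alpha> B C = \<lparr>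
     wt = (\<lambda>(x, x'). wt B x + wt C x'),
     qe = (\<lambda>i (x, x').
       if qphi B i x > 0 \<and> qeps C i x' > 0 then None else qe (tensor \<alpha> B C) i (x, x')),
     qf = (\<lambda>i (x, x').
       if qphi B i x > 0 \<and> qeps C i x' > 0 then None else qf (tensor \<alpha> B C) i (x, x')),
     qeps = (\<lambda>i (x, x').
       if qphi B i x > 0 \<and> qeps C i x' > 0 then \<infinity> else qeps (tensor \<alpha> B C) i (x, x')),
     qphi = (\<lambda>i (x, x').
       if qphi B i x > 0 \<and> qeps C i x' > 0 then \<infinity> else qphi (tensor \<alpha> B C) i (x, x')) \<rparr>"

definition tensor_quasi_crystal_monoid ::
    "'i set \<Rightarrow> ('i \<Rightarrow> 'v::euclidean_space) \<Rightarrow> 'v set \<Rightarrow> ('a, 'm) monoid_scheme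
      \<Rightarrow> ('a, 'i, 'v) quasi_crystal \<Rightarrow> bool" where
  "tensor_quasi_crystal_monoid I \<alpha> \<Lambda> M C \<longleftrightarrow>
     seminormal_quasi_crystal I \<alpha> \<Lambda> (carrier M) C \<and> monoid M \<and>
     quasi_crystal_hom I (carrier M \<times> carrier M) (tensor \<alpha> C C) (carrier M) C
       (map_option (\<lambda>(x, y). x \<otimes>\<^bsub>M\<^esub> y))"

definition quasi_tensor_quasi_crystal_monoid ::
    "'i set \<Rightarrow> ('i \<Rightarrow> 'v::euclidean_space) \<Rightarrow> 'v set \<Rightarrow> ('a, 'm) monoid_scheme
      \<Rightarrow> ('a, 'i, 'v) quasi_crystal \<Rightarrow> bool" where
  "quasi_tensor_quasi_crystal_monoid I \<alpha> \<Lambda> M C \<longleftrightarrow>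
     seminormal_quasi_crystal I \<alpha> \<Lambda> (carrier M) C \<and> monoid M \<and>
     quasi_crystal_hom I (carrier M \<times> carrier M) (quasi_tensor \<alpha> C C) (carrier M) C
       (map_option (\<lambda>(x, y). x \<otimes>\<^bsub>M\<^esub> y))"

definition equidivisible :: "('a, 'm) monoid_scheme \<Rightarrow> bool" where
  "equidivisible M \<longleftrightarrow>
     (\<forall>x1\<in>carrier M. \<forall>x2\<in>carrier M. \<forall>y1\<in>carrier M. \<forall>y2\<in>carrier M.
        x1 \<otimes>\<^bsub>M\<^esub> y1 = x2 \<otimes>\<^bsub>M\<^esub> y2 \<longrightarrow>
        (\<exists>z\<in>carrier M. (x2 = x1 \<otimes>\<^bsub>M\<^esub> z \<and> y1 = z \<otimes>\<^bsub>M\<^esub> y2) \<or>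
                       (x1 = x2 \<otimes>\<^bsub>M\<^esub> z \<and> y2 = z \<otimes>\<^bsub>M\<^esub> y1)))"

end

theory Submission
  imports Defs
begin

text \<open>Call \<open>x\<close> split at \<open>i\<close> if \<open>x = x\<^sub>1 x\<^sub>2\<close> with \<open>\<phi>\<^sub>i x\<^sub>1 > 0\<close> and \<open>\<epsilon>\<^sub>i x\<^sub>2 > 0\<close>. By the tensor rule,
  \<open>e\<^sub>i\<close> and \<open>f\<^sub>i\<close> act on one of the two factors and keep both inequalities, so they preserve
  splitness, and hence also its negation as they are mutually inverse; this gives the
  seminormal axioms. A product with a split factor is split. If neither \<open>x\<close> nor \<open>y\<close> is split,
  equidivisibility refines any splitting of \<open>x y\<close> to a factorization of \<open>x\<close> or of \<open>y\<close>, whose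
  middle factor has \<open>\<epsilon>\<^sub>i\<close> or \<open>\<phi>\<^sub>i\<close> equal to zero; so \<open>x y\<close> is split exactly when
  \<open>\<phi>\<^sub>i x > 0\<close> and \<open>\<epsilon>\<^sub>i y > 0\<close>, which is the exceptional case of the quasi-tensor product.\<close>

section \<open>Iterates of partial maps, and homomorphisms induced by total maps\<close>

lemma iterate_Suc_front: "iterate g (Suc k) x = Option.bind (g x) (iterate g k)"
  by (induction k) (auto simp: bind_assoc)

text \<open>The orbit under \<open>h\<close> never leaves \<open>P\<close>, where the two maps
  agree. It is applied with \<open>P\<close> the nonsplit elements, to carry maximal iteration
  counts over from the original operators to the modified ones.\<close>

lemma iterate_cong_on:
  assumes "P x" "\<And>y. P y \<Longrightarrow> g y = h y" "\<And>y z. P y \<Longrightarrow> h y = Some z \<Longrightarrow> P z"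
  shows "iterate g k x = iterate h k x"
  using assms(1)
proof (induction k arbitrary: x)
  case (Suc k)
  then show ?case
    unfolding iterate_Suc_front using assms(2,3) by (cases "h x") auto
qed simp

text \<open>Any positive number of iterations begins with one application of \<open>g\<close>, so a
  positive exponent is admissible exactly when the exponent 1 is.\<close>

lemma max_iterations_pos_iff:
  assumes "max_iterations g x m"
  shows "m > 0 \<longleftrightarrow> g x \<noteq> None"
proof -
  let ?S = "{k. iterate g k x \<noteq> None}"
  have fin: "finite ?S" and m: "m = Fin (int (Max ?S))"
    using assms by (auto simp: max_iterations_def)
  have "0 < Max ?S \<longleftrightarrow> (\<exists>k\<in>?S. 0 < k)"
    using fin by (subst Max_gr_iff) (auto intro: exI[of _ 0])
  also have "\<dots> \<longleftrightarrow> g x \<noteq> None"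
  proof
    assume "\<exists>k\<in>?S. 0 < k"
    then obtain k where "iterate g (Suc k) x \<noteq> None"
      by (metis (mono_tags) gr0_conv_Suc mem_Collect_eq)
    then show "g x \<noteq> None"
      unfolding iterate_Suc_front by (cases "g x") auto
  next
    assume "g x \<noteq> None"
    then have "1 \<in> ?S"
      by simp
    then show "\<exists>k\<in>?S. 0 < k"
      by (intro bexI[of _ 1]) auto
  qed
  finally show ?thesis
    by (simp add: m zero_extended_def)
qed

lemma max_iterations_nonneg: "max_iterations g x m \<Longrightarrow> \<exists>k\<ge>0. m = Fin k"
  by (auto simp: max_iterations_def)

text \<open>The exponents admissible at \<open>x\<close> are 0 and the successors of those
  admissible at \<open>y\<close>, so the maximum goes up by exactly one.\<close>

lemma max_iterations_step:
  assumes "max_iterations g x m" "g x = Some y" "max_iterations g y n"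
  shows "m = n + 1"
proof -
  let ?S = "\<lambda>x. {k. iterate g k x \<noteq> None}"
  have "k \<in> ?S x \<longleftrightarrow> k = 0 \<or> k \<in> Suc ` ?S y" for k
  proof (cases k)
    case (Suc l)
    then show ?thesis
      using assms(2) iterate_Suc_front[of g l x] by auto
  qed simp
  then have "?S x = insert 0 (Suc ` ?S y)"
    by blast
  moreover have fin: "finite (?S y)" and ne: "?S y \<noteq> {}"
    using assms(3) by (auto simp: max_iterations_def intro: exI[of _ 0])
  ultimately have "Max (?S x) = Max (Suc ` ?S y)"
    by simp
  also have "\<dots> = Suc (Max (?S y))"
    using mono_Max_commute[of Suc "?S y"] fin ne by (simp add: mono_Suc)
  finally show ?thesis
    using assms by (simp add: max_iterations_def one_extended_def)
qed

text \<open>A map of the form \<open>map_option h\<close> is undefined only at \<open>None\<close>,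
  so the provisos in the definition about the image being defined all hold automatically.\<close>

lemma quasi_crystal_hom_map_option:
  "quasi_crystal_hom I P B Q C (map_option h) \<longleftrightarrow>
     (\<forall>x\<in>P. h x \<in> Q \<and> wt C (h x) = wt B x) \<and>
     (\<forall>i\<in>I. \<forall>x\<in>P. qeps C i (h x) = qeps B i x \<and> qphi C i (h x) = qphi B i x \<and>
        (\<forall>y. qe B i x = Some y \<longrightarrow> qe C i (h x) = Some (h y)) \<and>
        (\<forall>y. qf B i x = Some y \<longrightarrow> qf C i (h x) = Some (h y)))"
  (is "?L \<longleftrightarrow> ?R")
proof
  assume ?L
  then show ?R
    unfolding quasi_crystal_hom_def by (elim conjE, intro conjI ballI allI impI) auto
next
  assume ?R
  then show ?L
    unfolding quasi_crystal_hom_def by (elim conjE, intro conjI ballI allI impI) auto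
qed

section \<open>Splittings, and the tensor rules at one index\<close>

definition splits :: "('a, 'm) monoid_scheme \<Rightarrow> ('a, 'i, 'v) quasi_crystal \<Rightarrow> 'i \<Rightarrow> 'a \<Rightarrow> bool" where
  "splits M C i x \<longleftrightarrow>
     (\<exists>x1\<in>carrier M. \<exists>x2\<in>carrier M. x = x1 \<otimes>\<^bsub>M\<^esub> x2 \<and> qphi C i x1 > 0 \<and> qeps C i x2 > 0)"

lemma splitsI:
  "\<lbrakk>x \<in> carrier M; y \<in> carrier M; qphi C i x > 0; qeps C i y > 0\<rbrakk> \<Longrightarrow> splits M C i (x \<otimes>\<^bsub>M\<^esub> y)"
  by (auto simp: splits_def)

text \<open>Splittings at different indices do not interact, so one index is fixed here; the theorem
  interprets the locale at each index in turn.\<close>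

locale tensor_monoid_component = monoid M
  for M :: "('a, 'm) monoid_scheme" (structure) +
  fixes I :: "'i set" and \<alpha> :: "'i \<Rightarrow> 'v::euclidean_space" and \<Lambda> :: "'v set"
    and C :: "('a, 'i, 'v) quasi_crystal" and i :: 'i
  assumes tensor_monoid: "tensor_quasi_crystal_monoid I \<alpha> \<Lambda> M C"
    and i: "i \<in> I"
begin

abbreviation "e \<equiv> qe C i"
abbreviation "f \<equiv> qf C i"
abbreviation "\<epsilon> \<equiv> qeps C i"
abbreviation "\<phi> \<equiv> qphi C i"
abbreviation "split \<equiv> splits M C i"

lemma seminormal: "seminormal_quasi_crystal I \<alpha> \<Lambda> (carrier M) C"
  using tensor_monoid by (simp add: tensor_quasi_crystal_monoid_def)

lemma hom: "quasi_crystal_hom I (carrier M \<times> carrier M) (tensor \<alpha> C C) (carrier M) C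
    (map_option (\<lambda>(x, y). x \<otimes> y))"
  using tensor_monoid by (simp add: tensor_quasi_crystal_monoid_def)

lemma
  assumes "x \<in> carrier M"
  shows e_range: "e x \<in> insert None (Some ` carrier M)"
    and f_range: "f x \<in> insert None (Some ` carrier M)"
    and eps_range: "\<epsilon> x \<in> zinf"
    and phi_range: "\<phi> x \<in> zinf"
    and phi_eq: "\<phi> x = \<epsilon> x + Fin (pairing (wt C x) (\<alpha> i))"
    and wt_e: "\<forall>y. e x = Some y \<longrightarrow> wt C y = wt C x + \<alpha> i"
    and wt_f: "\<forall>y. f x = Some y \<longrightarrow> wt C y = wt C x - \<alpha> i"
    and e_iff_f: "\<forall>y\<in>carrier M. e x = Some y \<longleftrightarrow> f y = Some x"
    and undefined_infinite: "\<epsilon> x = \<infinity> \<longrightarrow> e x = None \<and> f x = None"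
    and max_iterations_finite:
      "\<epsilon> x \<noteq> \<infinity> \<longrightarrow> max_iterations e x (\<epsilon> x) \<and> max_iterations f x (\<phi> x)"
  using bspec[OF bspec[OF conjunct2[OF seminormal[unfolded seminormal_quasi_crystal_def]] i] assms]
  by - (elim conjE, assumption)+

lemma e_closed: "\<lbrakk>x \<in> carrier M; e x = Some y\<rbrakk> \<Longrightarrow> y \<in> carrier M"
  using e_range[of x] by auto

lemma f_closed: "\<lbrakk>x \<in> carrier M; f x = Some y\<rbrakk> \<Longrightarrow> y \<in> carrier M"
  using f_range[of x] by auto

lemma e_eq_iff: "\<lbrakk>x \<in> carrier M; y \<in> carrier M\<rbrakk> \<Longrightarrow> e x = Some y \<longleftrightarrow> f y = Some x"
  using bspec[OF e_iff_f] .

lemma max_iterations_eps: "\<lbrakk>x \<in> carrier M; \<epsilon> x \<noteq> \<infinity>\<rbrakk> \<Longrightarrow> max_iterations e x (\<epsilon> x)"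
  using max_iterations_finite[of x] by simp

lemma max_iterations_phi: "\<lbrakk>x \<in> carrier M; \<epsilon> x \<noteq> \<infinity>\<rbrakk> \<Longrightarrow> max_iterations f x (\<phi> x)"
  using max_iterations_finite[of x] by simp

lemma defined_finite: "\<lbrakk>x \<in> carrier M; e x \<noteq> None \<or> f x \<noteq> None\<rbrakk> \<Longrightarrow> \<epsilon> x \<noteq> \<infinity>"
  using undefined_infinite[of x] by auto

text \<open>\<open>\<epsilon> x\<close> and \<open>\<phi> x\<close> differ by an integer, so both
  are infinite or neither is; finite values count iterations and so are nonnegative. Recording the
  pairing as \<open>n - m\<close> turns the product formulas into integer arithmetic.\<close>

lemma eps_phi_cases:
  assumes "x \<in> carrier M"
  obtains (inf) "\<epsilon> x = \<infinity>" "\<phi> x = \<infinity>"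
  | (fin) m n where "\<epsilon> x = Fin m" "\<phi> x = Fin n" "0 \<le> m" "0 \<le> n"
      "pairing (wt C x) (\<alpha> i) = n - m"
proof (cases "\<epsilon> x = \<infinity>")
  case True
  then show ?thesis
    using phi_eq[OF assms] inf by simp
next
  case False
  then obtain m n where "m \<ge> 0" "\<epsilon> x = Fin m" "n \<ge> 0" "\<phi> x = Fin n"
    using max_iterations_nonneg max_iterations_eps max_iterations_phi assms by metis
  then show ?thesis
    using phi_eq[OF assms] fin[of m n] by simp
qed

lemma
  assumes "x \<in> carrier M" "y \<in> carrier M"
  shows eps_tensor: "\<epsilon> (x \<otimes> y) = qeps (tensor \<alpha> C C) i (x, y)"
    and phi_tensor: "\<phi> (x \<otimes> y) = qphi (tensor \<alpha> C C) i (x, y)"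
    and e_tensor: "qe (tensor \<alpha> C C) i (x, y) = Some (a, b) \<Longrightarrow> e (x \<otimes> y) = Some (a \<otimes> b)"
    and f_tensor: "qf (tensor \<alpha> C C) i (x, y) = Some (a, b) \<Longrightarrow> f (x \<otimes> y) = Some (a \<otimes> b)"
proof -
  have "(x, y) \<in> carrier M \<times> carrier M"
    using assms by simp
  note h = bspec[OF bspec[OF conjunct2[OF hom[unfolded quasi_crystal_hom_map_option]] i] this,
      unfolded prod.case]
  show "\<epsilon> (x \<otimes> y) = qeps (tensor \<alpha> C C) i (x, y)"
    using h by (elim conjE)
  show "\<phi> (x \<otimes> y) = qphi (tensor \<alpha> C C) i (x, y)"
    using h by (elim conjE)
  show "e (x \<otimes> y) = Some (a \<otimes> b)" if "qe (tensor \<alpha> C C) i (x, y) = Some (a, b)"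
    using conjunct1[OF conjunct2[OF conjunct2[OF h]], THEN spec, THEN mp, OF that] by simp
  show "f (x \<otimes> y) = Some (a \<otimes> b)" if "qf (tensor \<alpha> C C) i (x, y) = Some (a, b)"
    using conjunct2[OF conjunct2[OF conjunct2[OF h]], THEN spec, THEN mp, OF that] by simp
qed

lemma eps_mult: "\<lbrakk>x \<in> carrier M; y \<in> carrier M\<rbrakk> \<Longrightarrow>
    \<epsilon> (x \<otimes> y) = max (\<epsilon> x) (\<epsilon> y - Fin (pairing (wt C x) (\<alpha> i)))"
  by (simp add: eps_tensor) (simp add: tensor_def)

lemma phi_mult: "\<lbrakk>x \<in> carrier M; y \<in> carrier M\<rbrakk> \<Longrightarrow>
    \<phi> (x \<otimes> y) = max (\<phi> x + Fin (pairing (wt C y) (\<alpha> i))) (\<phi> y)"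
  by (simp add: phi_tensor) (simp add: tensor_def)

lemma e_mult_left:
  "\<lbrakk>x \<in> carrier M; y \<in> carrier M; \<epsilon> y \<le> \<phi> x; e x = Some a\<rbrakk> \<Longrightarrow> e (x \<otimes> y) = Some (a \<otimes> y)"
  by (rule e_tensor) (auto simp: tensor_def)

lemma e_mult_right:
  "\<lbrakk>x \<in> carrier M; y \<in> carrier M; \<phi> x < \<epsilon> y; e y = Some b\<rbrakk> \<Longrightarrow> e (x \<otimes> y) = Some (x \<otimes> b)"
  by (rule e_tensor) (auto simp: tensor_def)

lemma f_mult_left:
  "\<lbrakk>x \<in> carrier M; y \<in> carrier M; \<epsilon> y < \<phi> x; f x = Some a\<rbrakk> \<Longrightarrow> f (x \<otimes> y) = Some (a \<otimes> y)"
  by (rule f_tensor) (auto simp: tensor_def)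

lemma f_mult_right:
  "\<lbrakk>x \<in> carrier M; y \<in> carrier M; \<phi> x \<le> \<epsilon> y; f y = Some b\<rbrakk> \<Longrightarrow> f (x \<otimes> y) = Some (x \<otimes> b)"
  by (rule f_tensor) (auto simp: tensor_def)

section \<open>Arrows and the transport of splittings along them\<close>

lemma e_defined_iff: "\<lbrakk>x \<in> carrier M; \<epsilon> x \<noteq> \<infinity>\<rbrakk> \<Longrightarrow> e x \<noteq> None \<longleftrightarrow> \<epsilon> x > 0"
  using max_iterations_pos_iff max_iterations_eps by metis

lemma f_defined_iff: "\<lbrakk>x \<in> carrier M; \<epsilon> x \<noteq> \<infinity>\<rbrakk> \<Longrightarrow> f x \<noteq> None \<longleftrightarrow> \<phi> x > 0"
  using max_iterations_pos_iff max_iterations_phi by metis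

text \<open>An \<open>e\<close>-chain from \<open>x\<close> passes first through \<open>y\<close>,
  and an \<open>f\<close>-chain from \<open>y\<close> passes first through \<open>x\<close>. Shifts
  along \<open>f\<close>-arrows are obtained below by reversing the arrow.\<close>

lemma e_shift:
  assumes x: "x \<in> carrier M" and e: "e x = Some y"
  shows "\<epsilon> x = \<epsilon> y + 1" "\<phi> y = \<phi> x + 1"
proof -
  have y: "y \<in> carrier M" and f: "f y = Some x"
    using x e e_closed e_eq_iff by blast+
  have "\<epsilon> x \<noteq> \<infinity>" "\<epsilon> y \<noteq> \<infinity>"
    using defined_finite x y e f by auto
  then show "\<epsilon> x = \<epsilon> y + 1" "\<phi> y = \<phi> x + 1"
    using max_iterations_step max_iterations_eps max_iterations_phi x y e f by metis+
qed

text \<open>The new splitting is the old one with one factor moved. On the left factor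
  \<open>e\<close> raises \<phi>; on the right it lowers \<epsilon>, but only from a value of at
  least 2.\<close>

lemma split_e:
  assumes x: "x \<in> carrier M" and ex: "e x = Some y" and s: "split x"
  shows "split y"
proof -
  obtain a b where ab: "a \<in> carrier M" "b \<in> carrier M" "x = a \<otimes> b" and pos: "\<phi> a > 0" "\<epsilon> b > 0"
    using s by (auto simp: splits_def)
  have fin: "\<epsilon> x \<noteq> \<infinity>" "\<epsilon> x > 0"
    using defined_finite e_defined_iff x ex by auto
  have eps: "\<epsilon> x = max (\<epsilon> a) (\<epsilon> b - Fin (pairing (wt C a) (\<alpha> i)))"
    using ab eps_mult by simp
  show ?thesis
  proof (cases "\<epsilon> b \<le> \<phi> a")
    case True
    \<comment> \<open>Subtracting the pairing of \<open>a\<close> from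
      \<open>\<epsilon> b \<le> \<phi> a\<close> bounds the second entry of the maximum by
      \<open>\<epsilon> a\<close>, so \<open>\<epsilon> a = \<epsilon> x\<close>.\<close>
    have "\<epsilon> a > 0"
      using fin eps True
      by - (cases rule: eps_phi_cases[OF ab(1)]; cases rule: eps_phi_cases[OF ab(2)];
          auto simp: zero_extended_def max_def split: if_splits)
    moreover have "\<epsilon> a \<noteq> \<infinity>"
      using fin eps by auto
    ultimately obtain a' where a': "e a = Some a'"
      using e_defined_iff ab by blast
    then have "\<phi> a' > 0"
      using e_shift[OF ab(1) a'] pos by (cases "\<phi> a") (auto simp: zero_extended_def one_extended_def)
    moreover have "y = a' \<otimes> b"
      using e_mult_left[OF ab(1,2) True a'] ex ab by simp
    ultimately show ?thesis
      using splitsI[of a' M b C i] ab(2) pos(2) e_closed[OF ab(1) a'] by simp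
  next
    case False
    then have lt: "\<phi> a < \<epsilon> b"
      by simp
    have "\<epsilon> b \<noteq> \<infinity>"
      using fin eps by auto
    then obtain b' where b': "e b = Some b'"
      using e_defined_iff ab pos by blast
    \<comment> \<open>Here \<open>\<epsilon> b > \<phi> a \<ge> 1\<close>, so one unit may be
      lost.\<close>
    have "\<epsilon> b' > 0"
      using e_shift(1)[OF ab(2) b'] pos lt
      by (cases "\<phi> a"; cases "\<epsilon> b'") (auto simp: zero_extended_def one_extended_def)
    moreover have "y = a \<otimes> b'"
      using e_mult_right[OF ab(1,2) lt b'] ex ab by simp
    ultimately show ?thesis
      using splitsI[of a M b' C i] ab(1) pos(1) e_closed[OF ab(2) b'] by simp
  qed
qed

text \<open>Dual to the case of \<open>e\<close>: on the left factor \<open>f\<close> lowers \<phi>,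
  which exceeds \<open>\<epsilon> b \<ge> 1\<close>, and on the right it raises \<epsilon>.\<close>

lemma split_f:
  assumes x: "x \<in> carrier M" and fx: "f x = Some y" and s: "split x"
  shows "split y"
proof -
  obtain a b where ab: "a \<in> carrier M" "b \<in> carrier M" "x = a \<otimes> b" and pos: "\<phi> a > 0" "\<epsilon> b > 0"
    using s by (auto simp: splits_def)
  have fin: "\<epsilon> x \<noteq> \<infinity>" "\<phi> x > 0"
    using defined_finite f_defined_iff x fx by auto
  have eps: "\<epsilon> x = max (\<epsilon> a) (\<epsilon> b - Fin (pairing (wt C a) (\<alpha> i)))"
    using ab eps_mult by simp
  have phi: "\<phi> x = max (\<phi> a + Fin (pairing (wt C b) (\<alpha> i))) (\<phi> b)"
    using ab phi_mult by simp
  have fa: "\<epsilon> a \<noteq> \<infinity>" and fb: "\<epsilon> b \<noteq> \<infinity>"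
    using fin eps by auto
  show ?thesis
  proof (cases "\<epsilon> b < \<phi> a")
    case True
    obtain a' where a': "f a = Some a'"
      using f_defined_iff ab pos fa by blast
    have "a' \<in> carrier M" "e a' = Some a"
      using a' ab e_eq_iff f_closed by blast+
    from e_shift(2)[OF this] have "\<phi> a' > 0"
      using pos True
      by (cases "\<epsilon> b"; cases "\<phi> a'") (auto simp: zero_extended_def one_extended_def)
    moreover have "y = a' \<otimes> b"
      using f_mult_left[OF ab(1,2) True a'] fx ab by simp
    ultimately show ?thesis
      using splitsI[of a' M b C i] ab(2) pos(2) f_closed[OF ab(1) a'] by simp
  next
    case False
    then have le: "\<phi> a \<le> \<epsilon> b"
      by simp
    \<comment> \<open>Adding the pairing of \<open>b\<close> to
      \<open>\<phi> a \<le> \<epsilon> b\<close> bounds the first entry of the maximum by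
      \<open>\<phi> b\<close>, so \<open>\<phi> b = \<phi> x\<close>.\<close>
    have "\<phi> b > 0"
      using fin phi le fb
      by - (cases rule: eps_phi_cases[OF ab(1)]; cases rule: eps_phi_cases[OF ab(2)];
          auto simp: zero_extended_def max_def split: if_splits)
    then obtain b' where b': "f b = Some b'"
      using f_defined_iff ab fb by blast
    have "b' \<in> carrier M" "e b' = Some b"
      using b' ab e_eq_iff f_closed by blast+
    from e_shift(1)[OF this] have "\<epsilon> b' > 0"
      using pos by (cases "\<epsilon> b") (auto simp: zero_extended_def one_extended_def)
    moreover have "y = a \<otimes> b'"
      using f_mult_right[OF ab(1,2) le b'] fx ab by simp
    ultimately show ?thesis
      using splitsI[of a M b' C i] ab(1) pos(1) f_closed[OF ab(2) b'] by simp
  qed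
qed

section \<open>Splittings of products\<close>

lemma split_mult_left:
  assumes "x \<in> carrier M" "y \<in> carrier M" "split x"
  shows "split (x \<otimes> y)"
proof -
  obtain a b where ab: "a \<in> carrier M" "b \<in> carrier M" "x = a \<otimes> b" "\<phi> a > 0" "\<epsilon> b > 0"
    using assms by (auto simp: splits_def)
  \<comment> \<open>\<open>\<epsilon> b\<close> is an entry of the maximum giving
    \<open>\<epsilon> (b \<otimes> y)\<close>; the new splitting is
    \<open>a \<otimes> (b \<otimes> y)\<close>.\<close>
  then have "\<epsilon> (b \<otimes> y) > 0"
    using eps_mult[OF ab(2) assms(2)] by (simp add: less_max_iff_disj)
  then show ?thesis
    using splitsI[of a M "b \<otimes> y" C i] ab assms by (simp add: m_assoc)
qed

lemma split_mult_right:
  assumes "x \<in> carrier M" "y \<in> carrier M" "split y"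
  shows "split (x \<otimes> y)"
proof -
  obtain a b where ab: "a \<in> carrier M" "b \<in> carrier M" "y = a \<otimes> b" "\<phi> a > 0" "\<epsilon> b > 0"
    using assms by (auto simp: splits_def)
  \<comment> \<open>\<open>\<phi> a\<close> is an entry of the maximum giving
    \<open>\<phi> (x \<otimes> a)\<close>; the new splitting is
    \<open>(x \<otimes> a) \<otimes> b\<close>.\<close>
  then have "\<phi> (x \<otimes> a) > 0"
    using phi_mult[OF assms(1) ab(1)] by (simp add: less_max_iff_disj)
  then show ?thesis
    using splitsI[of "x \<otimes> a" M b C i] ab assms by (simp add: m_assoc)
qed

lemma eps_zero: "\<lbrakk>x \<in> carrier M; \<not> 0 < \<epsilon> x\<rbrakk> \<Longrightarrow> \<epsilon> x = 0"
  by (cases rule: eps_phi_cases[of x]) (auto simp: zero_extended_def)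

lemma phi_zero: "\<lbrakk>x \<in> carrier M; \<not> 0 < \<phi> x\<rbrakk> \<Longrightarrow> \<phi> x = 0"
  by (cases rule: eps_phi_cases[of x]) (auto simp: zero_extended_def)

text \<open>If \<open>\<phi> z = 0\<close>, the pairing of \<open>z\<close> is
  \<open>- \<epsilon> z \<le> 0\<close>, so multiplying by \<open>z\<close> on the right cannot
  raise \<phi> and on the left cannot lower \<epsilon>. If \<open>\<epsilon> z = 0\<close>, the
  pairing is \<open>\<phi> z \<ge> 0\<close>, with the opposite effects. These four facts serve to
  cancel or insert the middle factor from equidivisibility.\<close>

lemma phi_pos_mult_right_zero:
  assumes "x \<in> carrier M" "z \<in> carrier M" "\<phi> z = 0" "\<phi> (x \<otimes> z) > 0"
  shows "\<phi> x > 0"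
  using assms(3,4) phi_mult[OF assms(1,2)]
  by - (cases rule: eps_phi_cases[OF assms(1)]; cases rule: eps_phi_cases[OF assms(2)];
        auto simp: zero_extended_def max_def split: if_splits)

lemma eps_pos_mult_left_zero:
  assumes "z \<in> carrier M" "y \<in> carrier M" "\<epsilon> z = 0" "\<epsilon> (z \<otimes> y) > 0"
  shows "\<epsilon> y > 0"
  using assms(3,4) eps_mult[OF assms(1,2)]
  by - (cases rule: eps_phi_cases[OF assms(1)]; cases rule: eps_phi_cases[OF assms(2)];
        auto simp: zero_extended_def max_def split: if_splits)

lemma phi_pos_mult_eps_zero:
  assumes "x \<in> carrier M" "z \<in> carrier M" "\<epsilon> z = 0" "\<phi> x > 0"
  shows "\<phi> (x \<otimes> z) > 0"
  using assms(3,4) phi_mult[OF assms(1,2)]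
  by - (cases rule: eps_phi_cases[OF assms(1)]; cases rule: eps_phi_cases[OF assms(2)];
        auto simp: zero_extended_def max_def split: if_splits)

lemma eps_pos_mult_phi_zero:
  assumes "z \<in> carrier M" "y \<in> carrier M" "\<phi> z = 0" "\<epsilon> y > 0"
  shows "\<epsilon> (z \<otimes> y) > 0"
  using assms(3,4) eps_mult[OF assms(1,2)]
  by - (cases rule: eps_phi_cases[OF assms(1)]; cases rule: eps_phi_cases[OF assms(2)];
        auto simp: zero_extended_def max_def split: if_splits)

lemma split_mult_iff:
  assumes "equidivisible M" and x: "x \<in> carrier M" "\<not> split x" and y: "y \<in> carrier M" "\<not> split y"
  shows "split (x \<otimes> y) \<longleftrightarrow> \<phi> x > 0 \<and> \<epsilon> y > 0"
proof
  assume "split (x \<otimes> y)"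
  then obtain a b where ab: "a \<in> carrier M" "b \<in> carrier M" "x \<otimes> y = a \<otimes> b"
    and pos: "\<phi> a > 0" "\<epsilon> b > 0"
    by (auto simp: splits_def)
  then obtain z where z: "z \<in> carrier M"
    and "a = x \<otimes> z \<and> y = z \<otimes> b \<or> x = a \<otimes> z \<and> b = z \<otimes> y"
    using \<open>equidivisible M\<close> x y unfolding equidivisible_def by metis
  then consider "a = x \<otimes> z" "y = z \<otimes> b" | "x = a \<otimes> z" "b = z \<otimes> y"
    by blast
  then show "\<phi> x > 0 \<and> \<epsilon> y > 0"
  proof cases
    case 1
    \<comment> \<open>Otherwise \<open>y = z \<otimes> b\<close> would be a splitting of
      \<open>y\<close>.\<close>
    then have "\<phi> z = 0"
      using y(2) splitsI[OF z ab(2) _ pos(2)] phi_zero[OF z] by blast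
    then show ?thesis
      using 1 pos phi_pos_mult_right_zero[OF x(1) z] eps_pos_mult_phi_zero[OF z ab(2)] by simp
  next
    case 2
    \<comment> \<open>Otherwise \<open>x = a \<otimes> z\<close> would be a splitting of
      \<open>x\<close>.\<close>
    then have "\<epsilon> z = 0"
      using x(2) splitsI[OF ab(1) z pos(1)] eps_zero[OF z] by blast
    then show ?thesis
      using 2 pos eps_pos_mult_left_zero[OF z y(1)] phi_pos_mult_eps_zero[OF ab(1) z] by simp
  qed
qed (simp add: splitsI x y)

end

section \<open>The modified structure: seminormality and multiplicativity\<close>

theorem proposition5p4:
  fixes \<Phi> \<Lambda> :: "'v::euclidean_space set"
    and I :: "'i set"
    and \<alpha> :: "'i \<Rightarrow> 'v"
    and M :: "('a, 'm) monoid_scheme"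
    and C :: "('a, 'i, 'v) quasi_crystal"
    and e' f' :: "'i \<Rightarrow> 'a \<Rightarrow> 'a option"
    and eps' phi' :: "'i \<Rightarrow> 'a \<Rightarrow> int extended"
  assumes "root_datum \<Phi> I \<alpha> \<Lambda>"
    and "tensor_quasi_crystal_monoid I \<alpha> \<Lambda> M C"
    and "equidivisible M"
    and "\<And>i x. \<lbrakk>i \<in> I; x \<in> carrier M;
           \<exists>x1\<in>carrier M. \<exists>x2\<in>carrier M. x = x1 \<otimes>\<^bsub>M\<^esub> x2 \<and> qphi C i x1 > 0 \<and> qeps C i x2 > 0\<rbrakk>
         \<Longrightarrow> e' i x = None \<and> f' i x = None \<and> eps' i x = \<infinity> \<and> phi' i x = \<infinity>"
    and "\<And>i x. \<lbrakk>i \<in> I; x \<in> carrier M;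
           \<not> (\<exists>x1\<in>carrier M. \<exists>x2\<in>carrier M. x = x1 \<otimes>\<^bsub>M\<^esub> x2 \<and> qphi C i x1 > 0 \<and> qeps C i x2 > 0)\<rbrakk>
         \<Longrightarrow> e' i x = qe C i x \<and> f' i x = qf C i x \<and> eps' i x = qeps C i x \<and> phi' i x = qphi C i x"
  shows "quasi_tensor_quasi_crystal_monoid I \<alpha> \<Lambda> M
           \<lparr>wt = wt C, qe = e', qf = f', qeps = eps', qphi = phi'\<rparr>"
proof -
  let ?C = "\<lparr>wt = wt C, qe = e', qf = f', qeps = eps', qphi = phi'\<rparr>"
  have M: "monoid M"
    using assms(2) by (simp add: tensor_quasi_crystal_monoid_def)
  have comp: "tensor_monoid_component M I \<alpha> \<Lambda> C i" if "i \<in> I" for i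
    using that assms(2) M by (simp add: tensor_monoid_component_def tensor_monoid_component_axioms_def)
  have split: "e' i x = None" "f' i x = None" "eps' i x = \<infinity>" "phi' i x = \<infinity>"
    if "i \<in> I" "x \<in> carrier M" "splits M C i x" for i x
    using assms(4)[OF that(1,2)] that(3) by (auto simp: splits_def)
  have nonsplit: "e' i x = qe C i x" "f' i x = qf C i x" "eps' i x = qeps C i x" "phi' i x = qphi C i x"
    if "i \<in> I" "x \<in> carrier M" "\<not> splits M C i x" for i x
    using assms(5)[OF that(1,2)] that(3) by (auto simp: splits_def)
  have "seminormal_quasi_crystal I \<alpha> \<Lambda> (carrier M) ?C"
    unfolding seminormal_quasi_crystal_def
  proof (intro conjI ballI)
    fix x assume "x \<in> carrier M"
    then show "wt ?C x \<in> \<Lambda>"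
      using assms(2) by (simp add: tensor_quasi_crystal_monoid_def seminormal_quasi_crystal_def)
  next
    fix i x assume i: "i \<in> I" and x: "x \<in> carrier M"
    interpret tensor_monoid_component M I \<alpha> \<Lambda> C i
      using comp i .
    \<comment> \<open>At a split element the operators are undefined and both counts infinite, which
      satisfies these axioms outright; elsewhere the original axioms apply.\<close>
    show "qe ?C i x \<in> insert None (Some ` carrier M)"
      and "qf ?C i x \<in> insert None (Some ` carrier M)"
      and "qeps ?C i x \<in> zinf" and "qphi ?C i x \<in> zinf"
      and "qphi ?C i x = qeps ?C i x + Fin (pairing (wt ?C x) (\<alpha> i))"
      and "\<forall>y. qe ?C i x = Some y \<longrightarrow> wt ?C y = wt ?C x + \<alpha> i"
      and "\<forall>y. qf ?C i x = Some y \<longrightarrow> wt ?C y = wt ?C x - \<alpha> i"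
      and "qeps ?C i x = \<infinity> \<longrightarrow> qe ?C i x = None \<and> qf ?C i x = None"
      using split[OF i x] nonsplit[OF i x] e_range[OF x] f_range[OF x] eps_range[OF x]
        phi_range[OF x] phi_eq[OF x] wt_e[OF x] wt_f[OF x] undefined_infinite[OF x]
      by (cases "split x"; simp add: zinf_def)+
    \<comment> \<open>When exactly one of \<open>x\<close>, \<open>y\<close> is split, both sides
      fail: an original arrow between them would transport the splitting to the other end.\<close>
    show "qe ?C i x = Some y \<longleftrightarrow> qf ?C i y = Some x" if y: "y \<in> carrier M" for y
      using split[OF i x] nonsplit[OF i x] split[OF i y] nonsplit[OF i y]
        e_eq_iff[OF x y] split_e[OF x] split_f[OF y]
      by (cases "split x"; cases "split y") auto
    show "qeps ?C i x \<noteq> \<infinity> \<longrightarrow>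
        max_iterations (qe ?C i) x (qeps ?C i x) \<and> max_iterations (qf ?C i) x (qphi ?C i x)"
    proof
      assume "qeps ?C i x \<noteq> \<infinity>"
      then have ns: "\<not> split x"
        using split[OF i x] by auto
      let ?P = "\<lambda>y. y \<in> carrier M \<and> \<not> split y"
      \<comment> \<open>If \<open>z\<close> were split, the reverse arrow
        \<open>f z = Some y\<close> would make \<open>y\<close> split.\<close>
      have "?P z" if "?P y" "e y = Some z" for y z
        using that e_closed[of y z] e_eq_iff[of y z] split_f[of z y] by blast
      moreover have "?P z" if "?P y" "f y = Some z" for y z
        using that f_closed[of y z] e_eq_iff[of z y] split_e[of z y] by blast
      ultimately have "iterate (e' i) k x = iterate e k x" "iterate (f' i) k x = iterate f k x" for k
        using iterate_cong_on[of ?P x "e' i" e k] iterate_cong_on[of ?P x "f' i" f k]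
          nonsplit[OF i] x ns by blast+
      then show "max_iterations (qe ?C i) x (qeps ?C i x) \<and>
          max_iterations (qf ?C i) x (qphi ?C i x)"
        using max_iterations_finite[OF x] nonsplit[OF i x ns] \<open>qeps ?C i x \<noteq> \<infinity>\<close> by (simp add: max_iterations_def)
    qed
  qed
  moreover have "quasi_crystal_hom I (carrier M \<times> carrier M) (quasi_tensor \<alpha> ?C ?C) (carrier M) ?C
      (map_option (\<lambda>(x, y). x \<otimes>\<^bsub>M\<^esub> y))"
  proof -
    have closed: "x \<otimes>\<^bsub>M\<^esub> y \<in> carrier M" if "x \<in> carrier M" "y \<in> carrier M" for x y
      using monoid.m_closed[OF M that] .
    have "wt C (x \<otimes>\<^bsub>M\<^esub> y) = wt C x + wt C y" if "x \<in> carrier M" "y \<in> carrier M" for x y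
      using assms(2) that
      by (simp add: tensor_quasi_crystal_monoid_def quasi_crystal_hom_map_option tensor_def)
    moreover have
      "eps' i (x \<otimes>\<^bsub>M\<^esub> y) = qeps (quasi_tensor \<alpha> ?C ?C) i (x, y) \<and>
       phi' i (x \<otimes>\<^bsub>M\<^esub> y) = qphi (quasi_tensor \<alpha> ?C ?C) i (x, y) \<and>
       (\<forall>a b. qe (quasi_tensor \<alpha> ?C ?C) i (x, y) = Some (a, b) \<longrightarrow>
          e' i (x \<otimes>\<^bsub>M\<^esub> y) = Some (a \<otimes>\<^bsub>M\<^esub> b)) \<and>
       (\<forall>a b. qf (quasi_tensor \<alpha> ?C ?C) i (x, y) = Some (a, b) \<longrightarrow>
          f' i (x \<otimes>\<^bsub>M\<^esub> y) = Some (a \<otimes>\<^bsub>M\<^esub> b))"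
      if i: "i \<in> I" and x: "x \<in> carrier M" and y: "y \<in> carrier M" for i x y
    proof -
      interpret tensor_monoid_component M I \<alpha> \<Lambda> C i
        using comp i .
      note xy = closed[OF x y]
      have [simp]: "0 < (\<infinity> :: int extended)" "(\<infinity> :: int extended) \<noteq> 0"
          "0 \<noteq> (\<infinity> :: int extended)"
        by (simp_all add: zero_extended_def)
      have [simp]: "m < \<infinity> \<longleftrightarrow> m \<noteq> \<infinity>" for m :: "int extended"
        by (simp add: less_le)
      show ?thesis
      proof (cases "split x \<or> split y")
        case True
        then have s: "split (x \<otimes>\<^bsub>M\<^esub> y)"
          using split_mult_left split_mult_right x y by blast
        \<comment> \<open>A split factor has infinite modified counts. If the quasi-tensor product
          falls under its tensor formulas, the infinite entry dominates both maxima, and the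
          comparison of \<phi> with \<epsilon> sends both operators to that factor, where they are
          undefined.\<close>
        show ?thesis
          using True
        proof
          assume sx: "split x"
          then show ?thesis
            using split[OF i x sx] split[OF i xy s]
            by (auto simp: quasi_tensor_def tensor_def split: if_splits)
        next
          assume sy: "split y"
          then show ?thesis
            using split[OF i y sy] split[OF i xy s]
            by (auto simp: quasi_tensor_def tensor_def split: if_splits)
        qed
      next
        case False
        then have ns: "\<not> split x" "\<not> split y"
          by auto
        show ?thesis
        \<comment> \<open>On nonsplit factors the modified counts are the original ones, so this is
          precisely the exceptional condition of the quasi-tensor product.\<close>
        proof (cases "\<phi> x > 0 \<and> \<epsilon> y > 0")
          case True
          then have s: "split (x \<otimes>\<^bsub>M\<^esub> y)"
            by (simp add: splitsI x y)
          then show ?thesis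
            using True
            by (simp add: quasi_tensor_def split[OF i xy s] nonsplit[OF i x ns(1)]
                nonsplit[OF i y ns(2)])
        next
          case zero: False
          \<comment> \<open>This is where equidivisibility enters. With \<open>x\<close>,
            \<open>y\<close> and their product all nonsplit, the quasi-tensor values are the tensor
            values, and the given homomorphism supplies the claim.\<close>
          then have "\<not> split (x \<otimes>\<^bsub>M\<^esub> y)"
            using split_mult_iff[OF assms(3) x ns(1) y ns(2)] by simp
          note eqs = nonsplit[OF i x ns(1)] nonsplit[OF i y ns(2)] nonsplit[OF i xy this]
          have "qeps (quasi_tensor \<alpha> ?C ?C) i (x, y) = qeps (tensor \<alpha> C C) i (x, y)"
            "qphi (quasi_tensor \<alpha> ?C ?C) i (x, y) = qphi (tensor \<alpha> C C) i (x, y)"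
            "qe (quasi_tensor \<alpha> ?C ?C) i (x, y) = qe (tensor \<alpha> C C) i (x, y)"
            "qf (quasi_tensor \<alpha> ?C ?C) i (x, y) = qf (tensor \<alpha> C C) i (x, y)"
            by (simp_all add: quasi_tensor_def tensor_def eqs zero)
          then show ?thesis
            using eps_tensor[OF x y] phi_tensor[OF x y]
            by (simp add: eqs e_tensor[OF x y] f_tensor[OF x y])
        qed
      qed
    qed
    ultimately show ?thesis
      unfolding quasi_crystal_hom_map_option using closed
      by (intro conjI ballI) (auto simp: quasi_tensor_def)
  qed
  ultimately show ?thesis
    using M by (simp add: quasi_tensor_quasi_crystal_monoid_def)
qed

end
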